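(* Let $\kappa>0$, $r=1/\kappa$, and let $x,y\in\mathbb{R}^2$ with $0<\|x-y\|<2r$. There is no $\kappa$-constrained plane curve $\sigma:[0,s]\to\mathbb{R}^2$ in $\Sigma(x,y)$ such that $\sigma(t)\in\mathcal{E}$ for all $t\in(0,s)$.
   Context: Fix $\kappa>0$ and put $r=1/\kappa$. A $\kappa$-constrained plane curve is an arc-length parametrised curve $\sigma:[0,s]\to\mathbb{R}^2$ ($s>0$) which is $C^1$ and piecewise $C^2$ and satisfies $\|\sigma''(t)\|\le\kappa$ wherever $\sigma''(t)$ is defined. $\Sigma(x,y)$ is the set of $\kappa$-constrained plane curves with $\sigma(0)=x$ and $\sigma(s)=y$ (length and initial and final tangent vectors not prescribed). For $0<\|x-y\|<2r$ let $D_1,D_2$ be the two closed disks of radius $r$ whose boundary circles $C_1=\partial D_1$, $C_2=\partial D_2$ satisfy $C_1\cap C_2=\{x,y\}$. Set $\mathcal{I}=\mathrm{int}(D_1\cap D_2)$, $\mathcal{U}=D_1\cup D_2$ and $\mathcal{E}=\mathrm{int}(\mathcal{U})\setminus\mathrm{cl}(\mathcal{I})$. *)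

theory Defs
  imports "HOL-Analysis.Analysis"
begin

text \<open>
  A curve is a total function of which only the restriction to \<open>{0..s}\<close> matters; \<open>v\<close> is its
  velocity (one-sided at the endpoints), unique on \<open>{0..s}\<close>. The curve is piecewise
  \<open>C\<^sup>2\<close> in the sense that \<open>v\<close> is piecewise \<open>C\<^sup>1\<close>: there is a finite exceptional
  set, to which the endpoints may be added, off which \<open>v\<close> has a continuous derivative. The
  acceleration is bounded at every point of \<open>{0..s}\<close> at which it exists, and nothing is
  required at the points at which it does not.
\<close>

definition constrained_curve :: "real \<Rightarrow> real \<Rightarrow> (real \<Rightarrow> real ^ 2) \<Rightarrow> bool" where
  "constrained_curve \<kappa> s \<sigma> \<longleftrightarrow>
     0 < s \<and>
     (\<exists>v. (\<forall>t\<in>{0..s}. (\<sigma> has_vector_derivative v t) (at t within {0..s})) \<and>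
          continuous_on {0..s} v \<and>
          (\<forall>t\<in>{0..s}. norm (v t) = 1) \<and>
          v piecewise_C1_differentiable_on {0..s} \<and>
          (\<forall>t\<in>{0..s}. \<forall>a. (v has_vector_derivative a) (at t within {0..s}) \<longrightarrow> norm a \<le> \<kappa>))"

definition constrained_curves_between ::
    "real \<Rightarrow> real ^ 2 \<Rightarrow> real ^ 2 \<Rightarrow> (real \<times> (real \<Rightarrow> real ^ 2)) set" where
  "constrained_curves_between \<kappa> x y =
     {(s, \<sigma>). constrained_curve \<kappa> s \<sigma> \<and> \<sigma> 0 = x \<and> \<sigma> s = y}"

definition lens_region :: "(real ^ 2) set \<Rightarrow> (real ^ 2) set \<Rightarrow> (real ^ 2) set" where
  "lens_region D1 D2 = interior (D1 \<inter> D2)"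

definition crescent_region :: "(real ^ 2) set \<Rightarrow> (real ^ 2) set \<Rightarrow> (real ^ 2) set" where
  "crescent_region D1 D2 = interior (D1 \<union> D2) - closure (lens_region D1 D2)"

end

theory Submission
  imports Defs
begin

text \<open>
  The curve is connected, so it stays in one of the two crescents, say in \<open>int D\<^sub>1 - D\<^sub>2\<close>. Slide
  the circle \<open>C\<^sub>2\<close> in the direction of \<open>c\<^sub>1 - c\<^sub>2\<close>; the arcs facing that direction foliate the
  crescent, and \<open>arc_height\<close> is the distance by which \<open>C\<^sub>2\<close> has to be shifted to reach a
  given point. It vanishes at both ends of the curve and is positive in between, hence has a first
  maximum point \<open>t\<close>. Near \<open>t\<close> the curve lies inside the corresponding shifted disk, of radius
  \<open>1 / \<kappa>\<close>; there the curvature bound makes the squared distance to the centre a convex function of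
  arc length. As it also has a maximum at \<open>t\<close>, it is constant just before \<open>t\<close>, so \<open>t\<close> was not the
  first maximum point.
\<close>

section \<open>Curves touching a circle from inside\<close>

lemma nonneg_derivative_imp_le_except_finite:
  fixes f f' :: "real \<Rightarrow> real"
  assumes "finite S" "a \<le> b" "continuous_on {a..b} f"
    and deriv: "\<And>x. x \<in> {a<..<b} - S \<Longrightarrow> (f has_real_derivative f' x) (at x) \<and> 0 \<le> f' x"
  shows "f a \<le> f b"
proof -
  \<comment> \<open>The fundamental theorem for the gauge integral tolerates finitely many
    exceptional points. The value 0 there makes the integrand nonnegative everywhere.\<close>
  define g where "g x = (if x \<in> {a<..<b} - S then f' x else 0)" for x
  have "(g has_integral (f b - f a)) {a..b}"
  proof (rule fundamental_theorem_of_calculus_interior_strong)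
    show "finite S" "a \<le> b" "continuous_on {a..b} f" by fact+
    show "(f has_vector_derivative g x) (at x)" if "x \<in> {a<..<b} - S" for x
      using deriv[OF that] that
      by (simp add: g_def has_real_derivative_iff_has_vector_derivative)
  qed
  moreover have "0 \<le> g x" for x
    using deriv by (simp add: g_def)
  ultimately have "0 \<le> f b - f a"
    by (rule has_integral_nonneg)
  then show ?thesis by simp
qed

text \<open>At \<open>t0\<close> the squared distance to \<open>c\<close> has a maximum, so its
  derivative vanishes. Convexity makes the derivative nonpositive before \<open>t0\<close>, so the
  distance there is at least \<open>r\<close>; \<open>inside\<close> gives the converse.\<close>

lemma norm_eq_radius_before_tangency:
  fixes \<sigma> v a :: "real \<Rightarrow> 'a :: real_inner"
  assumes "finite S" "0 < \<delta>"
    and deriv: "\<And>t. \<bar>t - t0\<bar> < \<delta> \<Longrightarrow> (\<sigma> has_vector_derivative v t) (at t)"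
    and cont: "continuous_on {t0 - \<delta><..t0} v"
    and unit: "\<And>t. \<bar>t - t0\<bar> < \<delta> \<Longrightarrow> norm (v t) = 1"
    and acc: "\<And>t. \<bar>t - t0\<bar> < \<delta> \<Longrightarrow> t \<notin> S \<Longrightarrow>
                 (v has_vector_derivative a t) (at t) \<and> norm (a t) * r \<le> 1"
    and inside: "\<And>t. \<bar>t - t0\<bar> < \<delta> \<Longrightarrow> norm (\<sigma> t - c) \<le> r"
    and touch: "norm (\<sigma> t0 - c) = r"
    and t: "t0 - \<delta> < t" "t \<le> t0"
  shows "norm (\<sigma> t - c) = r"
proof -
  define G where "G t = v t \<bullet> (\<sigma> t - c)" for t
  have diff: "((\<lambda>t. \<sigma> t - c) has_vector_derivative v t) (at t)" if "\<bar>t - t0\<bar> < \<delta>" for t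
    using has_vector_derivative_diff[OF deriv[OF that] has_vector_derivative_const] by simp
  note inner_deriv = bounded_bilinear.has_vector_derivative[OF bounded_bilinear_inner]
  have sq: "((\<lambda>t. (norm (\<sigma> t - c))\<^sup>2) has_real_derivative 2 * G t) (at t)"
    if "\<bar>t - t0\<bar> < \<delta>" for t
    unfolding power2_norm_eq_inner has_real_derivative_iff_has_vector_derivative
    using inner_deriv[OF diff[OF that] diff[OF that]] by (simp add: G_def inner_commute)
  have "2 * G t0 = 0"
  proof (rule DERIV_local_max[OF sq])
    show "0 < \<delta>" by fact
    show "\<forall>u. \<bar>t0 - u\<bar> < \<delta> \<longrightarrow> (norm (\<sigma> u - c))\<^sup>2 \<le> (norm (\<sigma> t0 - c))\<^sup>2"
      using inside touch by (auto simp: abs_minus_commute intro!: power_mono)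
  qed (use \<open>0 < \<delta>\<close> in simp)
  then have G0: "G t0 = 0" by simp
  have G_nonpos: "G u \<le> 0" if u: "t0 - \<delta> < u" "u \<le> t0" for u
  proof -
    have "G u \<le> G t0"
    \<comment> \<open>\<open>G\<close> has derivative 1 + a . (\<sigma> - c) off \<open>S\<close>,
      which is at least 1 - |a| r \<ge> 0 by Cauchy-Schwarz; continuity of \<open>v\<close> carries
      the monotonicity across \<open>S\<close>.\<close>
    proof (rule nonneg_derivative_imp_le_except_finite[OF \<open>finite S\<close> \<open>u \<le> t0\<close>])
      have "continuous_on {u..t0} \<sigma>"
        using u by (intro continuous_at_imp_continuous_on ballI
            has_vector_derivative_continuous[OF deriv]) auto
      moreover have "continuous_on {u..t0} v"
        using u by (intro continuous_on_subset[OF cont]) auto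
      ultimately show "continuous_on {u..t0} G"
        unfolding G_def by (intro continuous_intros)
      fix w assume w: "w \<in> {u<..<t0} - S"
      then have w': "\<bar>w - t0\<bar> < \<delta>" "w \<notin> S" using u by auto
      have "(G has_real_derivative (v w \<bullet> v w + a w \<bullet> (\<sigma> w - c))) (at w)"
        unfolding G_def has_real_derivative_iff_has_vector_derivative
        using inner_deriv[OF conjunct1[OF acc[OF w']] diff[OF w'(1)]] .
      moreover have "\<bar>a w \<bullet> (\<sigma> w - c)\<bar> \<le> norm (a w) * r"
        using Cauchy_Schwarz_ineq2[of "a w" "\<sigma> w - c"]
          mult_left_mono[OF inside[OF w'(1)], of "norm (a w)"] by simp
      moreover have "v w \<bullet> v w = 1"
        using unit[OF w'(1)] by (simp add: norm_eq_1)
      ultimately show "(G has_real_derivative (v w \<bullet> v w + a w \<bullet> (\<sigma> w - c))) (at w) \<and>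
                       0 \<le> v w \<bullet> v w + a w \<bullet> (\<sigma> w - c)"
        using acc[OF w'] by linarith
    qed
    then show ?thesis using G0 by simp
  qed
  have "(norm (\<sigma> t0 - c))\<^sup>2 \<le> (norm (\<sigma> t - c))\<^sup>2"
  proof (rule DERIV_nonpos_imp_nonincreasing[OF \<open>t \<le> t0\<close>])
    fix u assume "t \<le> u" "u \<le> t0"
    then show "\<exists>y. ((\<lambda>t. (norm (\<sigma> t - c))\<^sup>2) has_real_derivative y) (at u) \<and> y \<le> 0"
      using sq[of u] G_nonpos[of u] t by (intro exI[of _ "2 * G u"]) auto
  qed
  then have "norm (\<sigma> t0 - c) \<le> norm (\<sigma> t - c)"
    using power2_le_imp_le norm_ge_zero by blast
  then show ?thesis
    using inside[of t] touch t by auto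
qed

section \<open>Height of a point above a circle\<close>

text \<open>
  The square of half the chord that the disk of radius \<open>r\<close> about \<open>c\<close> cuts out of the line through
  \<open>z\<close> in the direction of the unit vector \<open>e\<close>; negative if the line misses the disk.
\<close>
definition half_chord_sq :: "real \<Rightarrow> 'a::real_inner \<Rightarrow> 'a \<Rightarrow> 'a \<Rightarrow> real" where
  "half_chord_sq r c e z = r\<^sup>2 - (norm (z - c))\<^sup>2 + ((z - c) \<bullet> e)\<^sup>2"

text \<open>The smaller root M of |z - (c + M e)| = r: the minus sign selects the arc facing
  \<open>e\<close>. As \<open>sqrt\<close> is continuous on all reals, so is this function on the
  whole space.\<close>

definition arc_height :: "real \<Rightarrow> 'a::real_inner \<Rightarrow> 'a \<Rightarrow> 'a \<Rightarrow> real" where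
  "arc_height r c e z = (z - c) \<bullet> e - sqrt (half_chord_sq r c e z)"

lemma continuous_on_arc_height [continuous_intros]:
  "continuous_on A f \<Longrightarrow> continuous_on A (\<lambda>t. arc_height r c e (f t))"
  unfolding arc_height_def half_chord_sq_def by (intro continuous_intros)

text \<open>Pythagoras: moving the centre along \<open>e\<close> changes only the component parallel
  to \<open>e\<close>; the orthogonal one has square
  \<open>r\<^sup>2 - half_chord_sq r c e z\<close>.\<close>

lemma norm_diff_shifted_center:
  fixes e :: "'a::real_inner"
  assumes "norm e = 1"
  shows "(norm (z - (c + M *\<^sub>R e)))\<^sup>2 = r\<^sup>2 - half_chord_sq r c e z + ((z - c) \<bullet> e - M)\<^sup>2"
proof -
  have "(norm (z - (c + M *\<^sub>R e)))\<^sup>2 =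
      (norm (z - c))\<^sup>2 + (norm (M *\<^sub>R e))\<^sup>2 - 2 * ((z - c) \<bullet> (M *\<^sub>R e))"
    using dot_norm_neg[of "z - c" "M *\<^sub>R e"] by (simp add: diff_diff_eq)
  also have "\<dots> = (norm (z - c))\<^sup>2 + M\<^sup>2 - 2 * M * ((z - c) \<bullet> e)"
    by (simp only: norm_scaleR inner_scaleR_right assms power_mult_distrib power2_abs) simp
  finally show ?thesis
    by (simp add: half_chord_sq_def power2_diff)
qed

context
  fixes e :: "'a::real_inner" and c :: 'a and d r :: real
  assumes e: "norm e = 1" and d: "0 < d" and r: "0 < r"
begin

lemma half_chord_sq_pos_if_in_ball:
  assumes "norm (z - (c + d *\<^sub>R e)) < r"
  shows "\<bar>(z - c) \<bullet> e - d\<bar> < sqrt (half_chord_sq r c e z)"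
proof -
  have "(norm (z - (c + d *\<^sub>R e)))\<^sup>2 < r\<^sup>2"
    using assms by (intro power_strict_mono) auto
  then show ?thesis
    unfolding norm_diff_shifted_center[OF e, of z c d r]
    by (intro real_less_rsqrt) simp
qed

lemma arc_height_pos:
  assumes "norm (z - (c + d *\<^sub>R e)) < r" and "r < norm (z - c)"
  shows "0 < arc_height r c e z"
proof -
  have 1: "\<bar>(z - c) \<bullet> e - d\<bar> < sqrt (half_chord_sq r c e z)"
    by (rule half_chord_sq_pos_if_in_ball) fact
  have "r\<^sup>2 < (norm (z - c))\<^sup>2"
    using assms r by (intro power_strict_mono) auto
  then have "sqrt (half_chord_sq r c e z) < sqrt (((z - c) \<bullet> e)\<^sup>2)"
    by (intro real_sqrt_less_mono) (simp add: half_chord_sq_def)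
  then have "sqrt (half_chord_sq r c e z) < \<bar>(z - c) \<bullet> e\<bar>" by simp
  \<comment> \<open>\<open>1\<close> and \<open>d\<close> put \<open>(z - c) \<bullet> e\<close>
    above minus the half chord, so its absolute value can exceed the half chord only on the positive
    side.\<close>
  with 1 d show ?thesis unfolding arc_height_def by linarith
qed

lemma arc_height_eq_0:
  assumes "norm (z - (c + d *\<^sub>R e)) = r" and "norm (z - c) = r"
  shows "arc_height r c e z = 0"
proof -
  have *: "half_chord_sq r c e z = ((z - c) \<bullet> e)\<^sup>2"
    using assms by (simp add: half_chord_sq_def)
  have "((z - c) \<bullet> e)\<^sup>2 = ((z - c) \<bullet> e - d)\<^sup>2"
    using norm_diff_shifted_center[OF e, of z c d r] assms * by simp
  \<comment> \<open>Being equidistant from both centres, z has \<open>e\<close>-coordinate d/2. Its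
    sign matters: \<open>sqrt\<close> of the square returns the coordinate itself.\<close>
  then have "d * (d - 2 * ((z - c) \<bullet> e)) = 0"
    by (simp add: power2_eq_square algebra_simps)
  then have "0 \<le> (z - c) \<bullet> e" using d by simp
  then show ?thesis unfolding arc_height_def * by simp
qed

section \<open>The first maximum of the height along a curve\<close>

lemma no_constrained_curve_in_one_crescent:
  fixes \<sigma> v :: "real \<Rightarrow> 'a"
  assumes "0 < s" "finite S"
    and deriv: "\<And>t. t \<in> {0..s} \<Longrightarrow> (\<sigma> has_vector_derivative v t) (at t within {0..s})"
    and cont: "continuous_on {0..s} v"
    and unit: "\<And>t. t \<in> {0..s} \<Longrightarrow> norm (v t) = 1"
    and acc: "\<And>t. t \<in> {0<..<s} - S \<Longrightarrow>
                 \<exists>a. (v has_vector_derivative a) (at t) \<and> norm a * r \<le> 1"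
    and ends: "\<And>t. t = 0 \<or> t = s \<Longrightarrow> norm (\<sigma> t - (c + d *\<^sub>R e)) = r \<and> norm (\<sigma> t - c) = r"
    and crescent: "\<And>t. t \<in> {0<..<s} \<Longrightarrow> norm (\<sigma> t - (c + d *\<^sub>R e)) < r \<and> r < norm (\<sigma> t - c)"
  shows False
proof -
  define f where "f = arc_height r c e \<circ> \<sigma>"
  have cont_\<sigma>: "continuous_on {0..s} \<sigma>"
    using deriv by (rule continuous_on_vector_derivative)
  then have cont_f: "continuous_on {0..s} f"
    unfolding f_def comp_def by (intro continuous_intros)
  have pos: "0 < f t" if "t \<in> {0<..<s}" for t
    using arc_height_pos crescent[OF that] by (simp add: f_def)
  have zero: "f t = 0" if "t = 0 \<or> t = s" for t
    using arc_height_eq_0 ends[OF that] by (simp add: f_def)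
  obtain t1 where t1: "t1 \<in> {0..s}" "\<And>t. t \<in> {0..s} \<Longrightarrow> f t \<le> f t1"
    using continuous_attains_sup[of "{0..s}" f] cont_f \<open>0 < s\<close> by auto
  define M where "M = f t1"
  have le_M: "f t \<le> M" if "t \<in> {0..s}" for t
    using t1 that by (simp add: M_def)
  have "0 < M"
    using pos[of "s / 2"] le_M[of "s / 2"] \<open>0 < s\<close> by simp
  define T where "T = {t \<in> {0..s}. f t = M}"
  have "compact T"
  proof -
    have "closed ({0..s} \<inter> f -` {M})"
      using cont_f by (intro continuous_closed_preimage) auto
    then have "compact ({0..s} \<inter> ({0..s} \<inter> f -` {M}))"
      by (intro compact_Int_closed) auto
    moreover have "T = {0..s} \<inter> ({0..s} \<inter> f -` {M})" by (auto simp: T_def)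
    ultimately show ?thesis by simp
  qed
  moreover have "T \<noteq> {}" using t1 by (auto simp: T_def M_def)
  ultimately obtain t0 where t0: "t0 \<in> T" "\<And>t. t \<in> T \<Longrightarrow> t0 \<le> t"
    using compact_attains_inf[of T] by auto
  have "t0 \<noteq> 0" "t0 \<noteq> s"
    using t0(1) zero[of 0] zero[of s] \<open>0 < M\<close> by (auto simp: T_def)
  then have t0s: "0 < t0" "t0 < s" using t0(1) by (auto simp: T_def)
  define P where "P t = half_chord_sq r c e (\<sigma> t)" for t
  define q where "q t = (\<sigma> t - c) \<bullet> e" for t
  have f_eq: "f t = q t - sqrt (P t)" for t
    by (simp add: f_def arc_height_def P_def q_def)
  have P_pos: "0 < P t" if "t \<in> {0<..<s}" for t
  proof -
    have "0 < sqrt (P t)"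
      using half_chord_sq_pos_if_in_ball[of "\<sigma> t"] crescent[OF that] unfolding P_def by linarith
    then show ?thesis by simp
  qed
  have "continuous_on {0<..<s} q"
    unfolding q_def by (intro continuous_intros continuous_on_subset[OF cont_\<sigma>]) auto
  then have "isCont q t0"
    using t0s by (intro continuous_on_interior[of "{0<..<s}"]) auto
  then have "(q \<longlongrightarrow> q t0) (nhds t0)"
    by (simp add: isCont_def tendsto_at_iff_tendsto_nhds)
  \<comment> \<open>At \<open>t0\<close> the difference q - M is the positive half chord. Staying
    ahead of the shifted centre keeps the curve away from the rear arc of the shifted
    circle.\<close>
  moreover have "M < q t0"
    using P_pos[of t0] t0(1) t0s f_eq[of t0] by (auto simp: T_def)
  ultimately have "eventually (\<lambda>t. M < q t) (nhds t0)"
    by (rule order_tendstoD(1))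
  then obtain \<delta>0 where \<delta>0: "0 < \<delta>0" "\<And>t. \<bar>t - t0\<bar> < \<delta>0 \<Longrightarrow> M < q t"
    by (auto simp: eventually_nhds_metric dist_real_def)
  define \<delta> where "\<delta> = min \<delta>0 (min t0 (s - t0))"
  have \<delta>: "0 < \<delta>" using \<delta>0 t0s by (simp add: \<delta>_def)
  have near: "t \<in> {0<..<s}" "M < q t" if "\<bar>t - t0\<bar> < \<delta>" for t
    using that \<delta>0(2)[of t] by (auto simp: \<delta>_def)
  define C where "C = c + M *\<^sub>R e"
  have norm_C: "(norm (\<sigma> t - C))\<^sup>2 = r\<^sup>2 - P t + (q t - M)\<^sup>2" for t
    unfolding C_def P_def q_def by (rule norm_diff_shifted_center[OF e])
  \<comment> \<open>The circle equation fixes q - M only up to sign; \<open>near\<close> makes it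
    positive, so the point lies on the front arc.\<close>
  have on_C: "norm (\<sigma> t - C) = r \<longleftrightarrow> f t = M" if t: "\<bar>t - t0\<bar> < \<delta>" for t
  proof -
    have "norm (\<sigma> t - C) = r \<longleftrightarrow> (norm (\<sigma> t - C))\<^sup>2 = r\<^sup>2"
      using r by (simp add: power2_eq_iff_nonneg)
    also have "\<dots> \<longleftrightarrow> (q t - M)\<^sup>2 = (sqrt (P t))\<^sup>2"
      using P_pos[OF near(1)[OF t]] by (auto simp: norm_C)
    also have "\<dots> \<longleftrightarrow> q t - M = sqrt (P t)"
      using near(2)[OF t] P_pos[OF near(1)[OF t]] by (intro power2_eq_iff_nonneg) auto
    finally show ?thesis by (auto simp: f_eq)
  qed
  have in_C: "norm (\<sigma> t - C) \<le> r" if t: "\<bar>t - t0\<bar> < \<delta>" for t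
  proof -
    have "q t - M \<le> sqrt (P t)"
      using le_M[of t] near(1)[OF t] by (simp add: f_eq)
    then have "(q t - M)\<^sup>2 \<le> (sqrt (P t))\<^sup>2"
      using near(2)[OF t] by (intro power_mono) auto
    then have "(norm (\<sigma> t - C))\<^sup>2 \<le> r\<^sup>2"
      using P_pos[OF near(1)[OF t]] by (simp add: norm_C)
    then show ?thesis using r by (rule power2_le_imp_le[OF _ less_imp_le])
  qed
  have "\<forall>t. \<exists>a. t \<in> {0<..<s} - S \<longrightarrow> (v has_vector_derivative a) (at t) \<and> norm a * r \<le> 1"
    using acc by simp
  then obtain a where a: "\<And>t. t \<in> {0<..<s} - S \<Longrightarrow>
      (v has_vector_derivative a t) (at t) \<and> norm (a t) * r \<le> 1"
    by metis
  \<comment> \<open>Any time in the window strictly before \<open>t0\<close> would contradict the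
    choice of \<open>t0\<close> as the least element of \<open>T\<close>.\<close>
  have "norm (\<sigma> (t0 - \<delta> / 2) - C) = r"
  proof (rule norm_eq_radius_before_tangency[OF \<open>finite S\<close> \<delta>])
    show "(\<sigma> has_vector_derivative v t) (at t)" if "\<bar>t - t0\<bar> < \<delta>" for t
      using deriv[of t] near(1)[OF that] at_within_interior[of t "{0..s}"] by simp
    show "continuous_on {t0 - \<delta><..t0} v"
      using t0s by (intro continuous_on_subset[OF cont]) (auto simp: \<delta>_def)
    show "norm (v t) = 1" if "\<bar>t - t0\<bar> < \<delta>" for t
      using unit near(1)[OF that] by simp
    show "(v has_vector_derivative a t) (at t) \<and> norm (a t) * r \<le> 1"
      if "\<bar>t - t0\<bar> < \<delta>" "t \<notin> S" for t
      using a near(1)[OF that(1)] that(2) by simp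
    show "norm (\<sigma> t0 - C) = r"
      using on_C[of t0] \<delta> t0(1) by (simp add: T_def)
  qed (use in_C \<delta> in auto)
  then have "t0 - \<delta> / 2 \<in> T"
    using on_C[of "t0 - \<delta> / 2"] near(1)[of "t0 - \<delta> / 2"] \<delta> by (simp add: T_def)
  then show False using t0(2) \<delta> by fastforce
qed

end

section \<open>Separating the two crescents in the plane\<close>

lemma no_constrained_curve_in_ball_minus_cball:
  fixes c1 c2 :: "real ^ 2"
  assumes "0 < \<kappa>" "constrained_curve \<kappa> s \<sigma>" "c1 \<noteq> c2"
    and ends: "{\<sigma> 0, \<sigma> s} \<subseteq> sphere c1 (1 / \<kappa>) \<inter> sphere c2 (1 / \<kappa>)"
    and crescent: "\<sigma> ` {0<..<s} \<subseteq> ball c1 (1 / \<kappa>) - cball c2 (1 / \<kappa>)"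
  shows False
proof -
  define d where "d = norm (c1 - c2)"
  \<comment> \<open>The disk about \<open>c2\<close> slides towards \<open>c1\<close> and coincides
    with the disk about \<open>c1\<close> after the distance \<open>d\<close>.\<close>
  define e where "e = (c1 - c2) /\<^sub>R d"
  have d: "0 < d" and e: "norm e = 1" and c1: "c2 + d *\<^sub>R e = c1"
    using \<open>c1 \<noteq> c2\<close> by (simp_all add: d_def e_def)
  obtain v where v: "0 < s"
      "\<And>t. t \<in> {0..s} \<Longrightarrow> (\<sigma> has_vector_derivative v t) (at t within {0..s})"
      "continuous_on {0..s} v" "\<And>t. t \<in> {0..s} \<Longrightarrow> norm (v t) = 1"
      "v piecewise_C1_differentiable_on {0..s}"
      and bound: "\<And>t a. t \<in> {0..s} \<Longrightarrow> (v has_vector_derivative a) (at t within {0..s}) \<Longrightarrow>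
                    norm a \<le> \<kappa>"
    using assms(2) unfolding constrained_curve_def by blast
  obtain S where S: "finite S" "v C1_differentiable_on ({0..s} - S)"
    using v(5) unfolding piecewise_C1_differentiable_on_def by blast
  obtain a where a: "\<And>t. t \<in> {0..s} - S \<Longrightarrow> (v has_vector_derivative a t) (at t)"
    using S(2) unfolding C1_differentiable_on_def by blast
  show False
  proof (rule no_constrained_curve_in_one_crescent[OF e d _ \<open>0 < s\<close> \<open>finite S\<close> v(2-4)])
    show "0 < 1 / \<kappa>" using \<open>0 < \<kappa>\<close> by simp
    show "\<exists>a. (v has_vector_derivative a) (at t) \<and> norm a * (1 / \<kappa>) \<le> 1"
      if "t \<in> {0<..<s} - S" for t
      using a[of t] bound[of t "a t"] that \<open>0 < \<kappa>\<close>
      by (intro exI[of _ "a t"]) (auto simp: has_vector_derivative_at_within)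
    show "norm (\<sigma> t - (c2 + d *\<^sub>R e)) = 1 / \<kappa> \<and> norm (\<sigma> t - c2) = 1 / \<kappa>"
      if "t = 0 \<or> t = s" for t
      using ends that by (auto simp: c1 dist_norm norm_minus_commute)
    show "norm (\<sigma> t - (c2 + d *\<^sub>R e)) < 1 / \<kappa> \<and> 1 / \<kappa> < norm (\<sigma> t - c2)"
      if "t \<in> {0<..<s}" for t
    proof -
      have "\<sigma> t \<in> ball c1 (1 / \<kappa>) - cball c2 (1 / \<kappa>)" using crescent that by blast
      then show ?thesis by (auto simp: c1 dist_norm norm_minus_commute)
    qed
  qed
qed

lemma crescent_region_cball_subset:
  fixes c1 c2 :: "real ^ 2"
  assumes "ball c1 r \<inter> ball c2 r \<noteq> {}"
  shows "crescent_region (cball c1 r) (cball c2 r) \<subseteq>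
           (ball c1 r - cball c2 r) \<union> (ball c2 r - cball c1 r)"
proof -
  \<comment> \<open>A closed convex set with nonempty interior is the closure of its interior, so
    removing the closed lens leaves no point common to both disks.\<close>
  have "closure (interior (cball c1 r \<inter> cball c2 r)) = cball c1 r \<inter> cball c2 r"
    using assms by (subst convex_closure_interior) (auto simp: convex_Int closed_Int)
  \<comment> \<open>Off the closed set B, a neighbourhood contained in the union can be shrunk to
    lie in A.\<close>
  moreover have "interior (A \<union> B) - B \<subseteq> interior A" if "closed B" for A B :: "(real ^ 2) set"
    using that by (intro interior_maximal) (use interior_subset in \<open>auto simp: open_Diff\<close>)
  from this[of "cball c2 r" "cball c1 r"] this[of "cball c1 r" "cball c2 r"]
  have "interior (cball c1 r \<union> cball c2 r) - cball c2 r \<subseteq> ball c1 r"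
    "interior (cball c1 r \<union> cball c2 r) - cball c1 r \<subseteq> ball c2 r"
    by (simp_all add: Un_commute)
  ultimately show ?thesis
    unfolding crescent_region_def lens_region_def by blast
qed

theorem theorem4p8:
  fixes \<kappa> r :: real and x y c1 c2 :: "real ^ 2" and D1 D2 :: "(real ^ 2) set"
  assumes "\<kappa> > 0" and "r = 1 / \<kappa>"
    and "0 < norm (x - y)" and "norm (x - y) < 2 * r"
    and "D1 = cball c1 r" and "D2 = cball c2 r"
    and "frontier D1 \<inter> frontier D2 = {x, y}"
  shows "\<not> (\<exists>s \<sigma>. (s, \<sigma>) \<in> constrained_curves_between \<kappa> x y \<and>
               (\<forall>t\<in>{0<..<s}. \<sigma> t \<in> crescent_region D1 D2))"
proof
  assume "\<exists>s \<sigma>. (s, \<sigma>) \<in> constrained_curves_between \<kappa> x y \<and>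
               (\<forall>t\<in>{0<..<s}. \<sigma> t \<in> crescent_region D1 D2)"
  then obtain s \<sigma> where curve: "constrained_curve \<kappa> s \<sigma>" and xy: "\<sigma> 0 = x" "\<sigma> s = y"
    and crescent: "\<And>t. t \<in> {0<..<s} \<Longrightarrow> \<sigma> t \<in> crescent_region D1 D2"
    by (auto simp: constrained_curves_between_def)
  have "0 < r" using assms by simp
  have spheres: "{x, y} = sphere c1 r \<inter> sphere c2 r"
    using assms \<open>0 < r\<close> by simp
  have "0 < s" using curve by (simp add: constrained_curve_def)
  have "continuous_on {0..s} \<sigma>"
    using curve continuous_on_vector_derivative unfolding constrained_curve_def by blast
  then have conn: "connected (\<sigma> ` {0<..<s})"
    by (intro connected_continuous_image) (auto elim: continuous_on_subset)
  \<comment> \<open>The midpoint of the chord is strictly inside both disks, so the lens has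
    nonempty interior.\<close>
  have "midpoint x y \<in> open_segment x y"
    using assms(3) by simp
  then have mid: "dist c (midpoint x y) < r" if "dist c x = r" "dist c y = r" for c
    using dist_decreases_open_segment[of "midpoint x y" x y c] that by auto
  have "x \<in> sphere c1 r \<inter> sphere c2 r" "y \<in> sphere c1 r \<inter> sphere c2 r"
    using spheres by blast+
  then have "midpoint x y \<in> ball c1 r \<inter> ball c2 r"
    using mid by simp
  then have sub: "\<sigma> ` {0<..<s} \<subseteq> (ball c1 r - cball c2 r) \<union> (ball c2 r - cball c1 r)"
    using crescent crescent_region_cball_subset[of c1 r c2] assms(5,6) by blast
  have "\<sigma> (s / 2) \<in> \<sigma> ` {0<..<s}" using \<open>0 < s\<close> by simp
  \<comment> \<open>For equal centres both crescents would be empty, yet one contains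
    \<open>\<sigma> (s / 2)\<close>.\<close>
  then have "c1 \<noteq> c2" using sub ball_subset_cball by blast
  have ends: "{\<sigma> 0, \<sigma> s} \<subseteq> sphere c1 r \<inter> sphere c2 r" using spheres xy by simp
  \<comment> \<open>The crescents are open and disjoint, so the connected open part of the curve
    meets only one of them.\<close>
  have "(ball c1 r - cball c2 r) \<inter> \<sigma> ` {0<..<s} = {} \<or>
        (ball c2 r - cball c1 r) \<inter> \<sigma> ` {0<..<s} = {}"
    using sub ball_subset_cball
    by (intro connectedD[OF conn]) (auto simp: open_Diff)
  then consider "\<sigma> ` {0<..<s} \<subseteq> ball c1 r - cball c2 r" | "\<sigma> ` {0<..<s} \<subseteq> ball c2 r - cball c1 r"
    using sub by blast
  then show False
  proof cases
    case 1
    then show False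
      using no_constrained_curve_in_ball_minus_cball[OF assms(1) curve, of c1 c2]
        \<open>c1 \<noteq> c2\<close> ends assms(2) by simp
  next
    case 2
    then show False
      using no_constrained_curve_in_ball_minus_cball[OF assms(1) curve, of c2 c1]
        \<open>c1 \<noteq> c2\<close> ends assms(2) by simp
  qed
qed

end
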